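(* Let $k$ be a positive integer and let $\lambda\in\left(0,\frac{1}{k+1}\right)$. Then for every complex number $s$ with $k<\operatorname{Re}(s)<\frac{1-\lambda}{\lambda}$ we have $$\Gamma_{\lambda}(s+1)=\frac{s(s-1)\cdots(s-k)}{(1-\lambda)(1-2\lambda)\cdots(1-k\lambda)\,(1-(k+1)\lambda)^{s-k+1}}\;\Gamma_{\frac{\lambda}{1-(k+1)\lambda}}(s-k).$$
   Context: For real $\lambda\in(0,\infty)$ and complex $s$ with $0<\operatorname{Re}(s)<\frac1\lambda$, the degenerate gamma function is defined by $$\Gamma_{\lambda}(s)=\int_0^{\infty}(1+\lambda t)^{-\frac1\lambda}\,t^{s-1}\,dt .$$ Powers of positive real numbers with complex exponents are $x^{z}=e^{z\log x}$ with the real logarithm. *)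

theory Defs
  imports "HOL-Analysis.Analysis"
begin

text \<open>
  The integral converges absolutely for \<open>0 < lam\<close> and \<open>0 < Re s < 1/lam\<close>; only
  on this range is the definition meaningful. On the domain of integration \<open>t\<close> is
  positive, so the principal-branch \<open>complex_of_real t powr (s - 1)\<close> is
  \<open>exp ((s - 1) * complex_of_real (ln t))\<close>.
\<close>
definition degenerate_Gamma :: "real \<Rightarrow> complex \<Rightarrow> complex" where
  "degenerate_Gamma lam s =
     (LINT t:{0<..}|lborel.
        complex_of_real ((1 + lam * t) powr (- (1 / lam))) * complex_of_real t powr (s - 1))"

end

theory Submission
  imports Defs "HOL-Real_Asymp.Real_Asymp"
begin

text \<open>
  Fix \<open>lam > 0\<close> and let the exponent of the first factor vary independently of \<open>lam\<close>:
  put \<open>B(a, z) = \<integral>\<^sub>0\<^sup>\<infinity> (1 + lam t)\<^sup>-\<^sup>a t\<^sup>z\<^sup>-\<^sup>1 dt\<close>, so that the degenerate gamma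
  function at \<open>s\<close> is \<open>B(1/lam, s)\<close>. Integrating the derivative of
  \<open>(1 + lam t)\<^sup>-\<^sup>a t\<^sup>z\<close>, which vanishes at both ends when \<open>0 < Re z < a\<close>, gives
  \<open>a lam B(a + 1, z + 1) = z B(a, z)\<close> (\<open>beta_integral_recurrence\<close>). Each application lowers
  both parameters by one, and hence preserves the difference \<open>a - Re z\<close> on which convergence at
  infinity depends.

  Starting from \<open>B(1/lam, s + 1)\<close>, apply this \<open>k + 1\<close> times. The numerators multiply to
  \<open>s (s - 1) \<cdots> (s - k)\<close>, the denominators \<open>(1/lam - j) lam\<close> to
  \<open>(1 - lam) \<cdots> (1 - (k + 1) lam)\<close>, and what remains is \<open>B(1/lam - (k + 1), s - k)\<close>.
  With \<open>c = 1 - (k + 1) lam\<close> its exponent is \<open>c/lam\<close>, which is the exponent belonging to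
  the degenerate gamma function of parameter \<open>lam/c\<close>. Replacing \<open>t\<close> by \<open>t/c\<close> turns the base
  \<open>1 + lam t\<close> into \<open>1 + (lam/c) t\<close> at the cost of the factor \<open>c\<close> to the power \<open>-(s - k)\<close>
  (\<open>beta_integral_rescale\<close>). Together with the last denominator, which is \<open>c\<close> itself, this
  accounts for the power \<open>s - k + 1\<close> of \<open>c\<close>.
\<close>

text \<open>
  After the substitution \<open>u = lam t\<close> the integral below is a beta integral of the second kind. The
  exponent \<open>a\<close> is decoupled from \<open>lam\<close> because the recurrence changes \<open>a\<close> while keeping
  \<open>lam\<close>.
\<close>
definition beta_kernel :: "real \<Rightarrow> real \<Rightarrow> complex \<Rightarrow> real \<Rightarrow> complex" where
  "beta_kernel lam a z t =
     complex_of_real ((1 + lam * t) powr (- a)) * complex_of_real t powr (z - 1)"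

definition beta_integral :: "real \<Rightarrow> real \<Rightarrow> complex \<Rightarrow> complex" where
  "beta_integral lam a z = (LINT t:{0<..}|lborel. beta_kernel lam a z t)"

lemma degenerate_Gamma_eq_beta_integral:
  "degenerate_Gamma lam s = beta_integral lam (1 / lam) s"
  by (simp add: degenerate_Gamma_def beta_integral_def beta_kernel_def)

lemma norm_beta_kernel:
  assumes "t > 0"
  shows "norm (beta_kernel lam a z t) = (1 + lam * t) powr (- a) * t powr (Re z - 1)"
  using assms by (simp add: beta_kernel_def norm_mult norm_powr_real_powr)

lemma set_integrable_powr_near_0:
  fixes x c :: real
  assumes "x > 0" and "c > 0"
  shows "set_integrable lborel {0<..<c} (\<lambda>t. t powr (x - 1))"
proof -
  have "set_integrable lborel (einterval (ereal 0) (ereal c)) (\<lambda>t. t powr (x - 1))"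
  proof (rule interval_integral_FTC_nonneg(1))
    show "DERIV (\<lambda>t. t powr x / x) t :> t powr (x - 1)" if "ereal 0 < ereal t" for t
      using that assms by (auto intro!: derivative_eq_intros)
    show "isCont (\<lambda>t. t powr (x - 1)) t" if "ereal 0 < ereal t" for t
      using that by (auto intro!: continuous_intros)
    show "(((\<lambda>t. t powr x / x) \<circ> real_of_ereal) \<longlongrightarrow> 0) (at_right (ereal 0))"
      unfolding ereal_tendsto_simps using assms by real_asymp
    have "((\<lambda>t. t powr x / x) \<longlongrightarrow> c powr x / x) (at_left c)"
      using assms by (auto intro!: tendsto_eq_intros)
    then show "(((\<lambda>t. t powr x / x) \<circ> real_of_ereal) \<longlongrightarrow> c powr x / x) (at_left (ereal c))"
      unfolding ereal_tendsto_simps .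
  qed (use assms in auto)
  then show ?thesis by simp
qed

lemma set_integrable_powr_near_infinity:
  fixes y c :: real
  assumes "y < 0" and "c > 0"
  shows "set_integrable lborel {c<..} (\<lambda>t. t powr (y - 1))"
proof -
  have "set_integrable lborel (einterval (ereal c) \<infinity>) (\<lambda>t. t powr (y - 1))"
  proof (rule interval_integral_FTC_nonneg(1))
    show "DERIV (\<lambda>t. t powr y / y) t :> t powr (y - 1)" if "ereal c < ereal t" for t
      using that assms by (auto intro!: derivative_eq_intros)
    show "isCont (\<lambda>t. t powr (y - 1)) t" if "ereal c < ereal t" for t
      using that assms by (auto intro!: continuous_intros)
    have "((\<lambda>t. t powr y / y) \<longlongrightarrow> c powr y / y) (at_right c)"
      using assms by (auto intro!: tendsto_eq_intros)
    then show "(((\<lambda>t. t powr y / y) \<circ> real_of_ereal) \<longlongrightarrow> c powr y / y) (at_right (ereal c))"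
      unfolding ereal_tendsto_simps .
    show "(((\<lambda>t. t powr y / y) \<circ> real_of_ereal) \<longlongrightarrow> 0) (at_left \<infinity>)"
      unfolding ereal_tendsto_simps using assms by real_asymp
  qed (use assms in auto)
  then show ?thesis by simp
qed

text \<open>
  For \<open>a > 0\<close> the factor \<open>(1 + lam t)\<^sup>-\<^sup>a\<close> is bounded both by \<open>1\<close> and by
  \<open>(lam t)\<^sup>-\<^sup>a\<close>. The first bound gives integrability at \<open>0\<close> because \<open>0 < Re z\<close>, the second
  at infinity because \<open>Re z < a\<close>.
\<close>
lemma set_integrable_beta_kernel:
  assumes lam: "0 < lam" and z: "0 < Re z" "Re z < a"
  shows "set_integrable lborel {0<..} (beta_kernel lam a z)"
proof -
  have pos: "1 + lam * t > 0" if "t > 0" for t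
    using lam that by (simp add: add_pos_pos)
  have cont: "continuous_on {0<..} (beta_kernel lam a z)"
    unfolding beta_kernel_def using lam
    by (intro continuous_on_mult continuous_on_of_real continuous_on_powr continuous_on_powr_complex
              continuous_intros) (force dest: pos simp: complex_nonpos_Reals_iff)+
  have meas: "set_borel_measurable lborel A (beta_kernel lam a z)"
    if "open A" "A \<subseteq> {0<..}" for A
    using borel_measurable_continuous_on_indicator[OF _ continuous_on_subset[OF cont that(2)]] that(1)
    by (simp add: set_borel_measurable_def)
  have near_0: "set_integrable lborel {0<..<2} (beta_kernel lam a z)"
  proof (rule set_integrable_bound[OF set_integrable_powr_near_0[of "Re z" 2] meas])
    have "(1 + lam * t) powr (- a) \<le> 1" if "t > 0" for t
      using powr_mono[of "- a" 0 "1 + lam * t"] that lam z pos[OF that]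
      by (simp split: if_splits)
    then have "(1 + lam * t) powr (- a) * t powr (Re z - 1) \<le> 1 * t powr (Re z - 1)" if "t > 0" for t
      using that by (intro mult_right_mono) auto
    then show "AE t in lborel. t \<in> {0<..<2} \<longrightarrow>
        norm (beta_kernel lam a z t) \<le> norm (t powr (Re z - 1))"
      by (auto simp: norm_beta_kernel)
  qed (use z in auto)
  have near_infinity: "set_integrable lborel {1<..} (beta_kernel lam a z)"
  proof (rule set_integrable_bound[OF _ meas])
    show "set_integrable lborel {1<..} (\<lambda>t. lam powr (- a) * t powr (Re z - a - 1))"
      using z by (intro set_integrable_mult_right set_integrable_powr_near_infinity) auto
    have "(1 + lam * t) powr (- a) * t powr (Re z - 1) \<le> lam powr (- a) * t powr (Re z - a - 1)"
      if "t > 1" for t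
    proof -
      have "(1 + lam * t) powr (- a) \<le> (lam * t) powr (- a)"
        using that lam z by (intro powr_mono2') auto
      then have "(1 + lam * t) powr (- a) * t powr (Re z - 1) \<le> (lam * t) powr (- a) * t powr (Re z - 1)"
        by (intro mult_right_mono) auto
      also have "\<dots> = lam powr (- a) * t powr (- a + (Re z - 1))"
        unfolding powr_add using that lam by (simp add: powr_mult)
      also have "- a + (Re z - 1) = Re z - a - 1" by simp
      finally show ?thesis .
    qed
    then show "AE t in lborel. t \<in> {1<..} \<longrightarrow>
        norm (beta_kernel lam a z t) \<le> norm (lam powr (- a) * t powr (Re z - a - 1))"
      by (auto simp: norm_beta_kernel)
  qed auto
  \<comment> \<open>The two pieces overlap so that both can be open intervals.\<close>
  have "{0::real<..} = {0<..<2} \<union> {1<..}" by auto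
  then show ?thesis using set_integrable_Un[OF near_0 near_infinity] by simp
qed

text \<open>
  Integration by parts, in the form that the derivative of \<open>(1 + lam t)\<^sup>-\<^sup>a t\<^sup>z\<close> has integral
  zero. This function tends to \<open>0\<close> at the origin because \<open>Re z > 0\<close> and at infinity because
  \<open>Re z < a\<close>.
\<close>
lemma beta_integral_recurrence:
  assumes lam: "0 < lam" and z: "0 < Re z" "Re z < a"
  shows "of_real (a * lam) * beta_integral lam (a + 1) (z + 1) = z * beta_integral lam a z"
proof -
  define f where "f t = z * beta_kernel lam a z t
     - of_real (a * lam) * beta_kernel lam (a + 1) (z + 1) t" for t
  define F where "F = beta_kernel lam a (z + 1)"
  have int: "set_integrable lborel {0<..} (\<lambda>t. z * beta_kernel lam a z t)"
     "set_integrable lborel {0<..} (\<lambda>t. of_real (a * lam) * beta_kernel lam (a + 1) (z + 1) t)"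
    using lam z by (auto intro!: set_integrable_beta_kernel)
  have norm_F: "norm (F t) = (1 + lam * t) powr (- a) * t powr Re z" if "t > 0" for t
    using norm_beta_kernel[OF that] by (simp add: F_def)
  have "(LBINT t=ereal 0..\<infinity>. f t) = 0 - 0"
  proof (rule interval_integral_FTC_integrable)
    fix t assume "ereal 0 < ereal t"
    then have t: "t > 0" by simp
    then have pos: "1 + lam * t > 0" using lam by (simp add: add_pos_pos)
    have "((\<lambda>t. (1 + lam * t) powr (- a)) has_real_derivative - a * lam * (1 + lam * t) powr (- a - 1)) (at t)"
      using pos by (auto intro!: derivative_eq_intros)
    then have "((\<lambda>t. complex_of_real ((1 + lam * t) powr (- a))) has_vector_derivative
        of_real (- a * lam * (1 + lam * t) powr (- a - 1))) (at t)"
      by (rule has_vector_derivative_of_real)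
    moreover have "((\<lambda>t. complex_of_real t powr z) has_vector_derivative z * of_real t powr (z - 1)) (at t)"
      using t by (intro has_vector_derivative_real_field has_field_derivative_powr)
        (simp add: complex_nonpos_Reals_iff)
    ultimately have "((\<lambda>t. complex_of_real ((1 + lam * t) powr (- a)) * complex_of_real t powr z)
        has_vector_derivative
          complex_of_real ((1 + lam * t) powr (- a)) * (z * of_real t powr (z - 1))
          + of_real (- a * lam * (1 + lam * t) powr (- a - 1)) * of_real t powr z) (at t)"
      by (rule has_vector_derivative_mult)
    moreover have "F = (\<lambda>t. complex_of_real ((1 + lam * t) powr (- a)) * complex_of_real t powr z)"
      by (simp add: F_def beta_kernel_def fun_eq_iff)
    moreover have "f t = complex_of_real ((1 + lam * t) powr (- a)) * (z * of_real t powr (z - 1))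
          + of_real (- a * lam * (1 + lam * t) powr (- a - 1)) * of_real t powr z"
      by (simp add: f_def beta_kernel_def)
    ultimately show "(F has_vector_derivative f t) (at t)"
      by simp
    show "isCont f t"
      unfolding f_def beta_kernel_def using t pos
      by (intro continuous_intros) (auto simp: complex_nonpos_Reals_iff)
  next
    show "set_integrable lborel (einterval (ereal 0) \<infinity>) f"
      unfolding f_def using int by (auto intro: set_integral_diff(1))
  next
    have "((\<lambda>t. (1 + lam * t) powr (- a) * t powr Re z) \<longlongrightarrow> 0) (at_right 0)"
      using lam z by real_asymp
    then have "((\<lambda>t. norm (F t)) \<longlongrightarrow> 0) (at_right 0)"
      by (rule Lim_transform_eventually)
        (auto simp: norm_F intro!: eventually_at_right_less[THEN eventually_mono])
    then show "((F \<circ> real_of_ereal) \<longlongrightarrow> 0) (at_right (ereal 0))"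
      unfolding ereal_tendsto_simps by (rule tendsto_norm_zero_cancel)
  next
    have "((\<lambda>t. (1 + lam * t) powr (- a) * t powr Re z) \<longlongrightarrow> 0) at_top"
      using lam z by real_asymp
    then have "((\<lambda>t. norm (F t)) \<longlongrightarrow> 0) at_top"
      by (rule Lim_transform_eventually)
        (auto simp: norm_F intro!: eventually_gt_at_top[of 0, THEN eventually_mono])
    then show "((F \<circ> real_of_ereal) \<longlongrightarrow> 0) (at_left \<infinity>)"
      unfolding ereal_tendsto_simps by (rule tendsto_norm_zero_cancel)
  qed simp
  also have "(LBINT t=ereal 0..\<infinity>. f t) = (LINT t:{0<..}|lborel. f t)"
    by (rule interval_integral_to_infinity_eq)
  also have "\<dots> = z * beta_integral lam a z - of_real (a * lam) * beta_integral lam (a + 1) (z + 1)"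
    unfolding f_def beta_integral_def set_integral_diff(2)[OF int] by simp
  finally show ?thesis by simp
qed

text \<open>
  The shifted form \<open>s + 1\<close> makes the \<open>n\<close>-th step divide by \<open>(a - n) lam\<close> and multiply by
  \<open>s - (n - 1)\<close>. The lower bound on \<open>Re s\<close> weakens as \<open>n\<close> decreases, so the hypothesis for the
  last step covers all earlier ones.
\<close>
lemma beta_integral_iterated:
  assumes lam: "0 < lam" and s: "real n < Re s + 1" "Re s + 1 < a"
  shows "beta_integral lam a (s + 1) =
           (\<Prod>j<n. s - of_nat j) / (\<Prod>j=1..n. of_real ((a - real j) * lam))
             * beta_integral lam (a - real n) (s + 1 - of_nat n)"
  using s(1)
proof (induction n)
  case (Suc n)
  let ?b = "a - real (Suc n)" and ?z = "s - of_nat n"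
  have "of_real (?b * lam) * beta_integral lam (?b + 1) (?z + 1) = ?z * beta_integral lam ?b ?z"
    using lam s(2) Suc.prems by (intro beta_integral_recurrence) auto
  moreover have "?b * lam \<noteq> 0" using lam s(2) Suc.prems by auto
  ultimately have "beta_integral lam (?b + 1) (?z + 1)
      = ?z / of_real (?b * lam) * beta_integral lam ?b ?z"
    by (simp add: nonzero_eq_divide_eq mult.commute del: of_real_mult of_real_diff)
  moreover have "?b + 1 = a - real n" "?z + 1 = s + 1 - of_nat n" by simp_all
  ultimately have step: "beta_integral lam (a - real n) (s + 1 - of_nat n)
      = ?z / of_real (?b * lam) * beta_integral lam ?b ?z"
    by simp
  have "beta_integral lam a (s + 1) = (\<Prod>j<n. s - of_nat j) / (\<Prod>j=1..n. of_real ((a - real j) * lam))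
        * (?z / of_real (?b * lam) * beta_integral lam ?b ?z)"
    using Suc unfolding step by simp
  then show ?case by (simp add: mult_ac)
qed simp

text \<open>
  The substitution \<open>t \<mapsto> c t\<close>; it is valid for all \<open>m\<close>, \<open>a\<close> and \<open>z\<close>, since a linear change
  of variables preserves divergence too, and both sides are \<open>0\<close> if the integral diverges.
\<close>
lemma beta_integral_rescale:
  assumes "c > 0"
  shows "beta_integral (c * m) a z = of_real c powr (- z) * beta_integral m a z"
proof -
  have "beta_integral m a z
      = of_real c * (LINT t|lborel. indicator {0<..} (c * t) *\<^sub>R beta_kernel m a z (c * t))"
    unfolding beta_integral_def set_lebesgue_integral_def
    using assms by (subst lborel_integral_real_affine[of c _ 0]) (auto simp: scaleR_conv_of_real)
  also have "\<dots> = of_real c *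
      (LINT t:{0<..}|lborel. of_real c powr (z - 1) * beta_kernel (c * m) a z t)"
    unfolding set_lebesgue_integral_def
    using assms
    by (intro arg_cong2[of _ _ _ _ "(*)"] refl Bochner_Integration.integral_cong)
       (auto simp: indicator_def beta_kernel_def zero_less_mult_iff powr_times_real mult_ac)
  also have "\<dots> = of_real c powr z * beta_integral (c * m) a z"
    using assms by (simp add: beta_integral_def powr_diff)
  finally show ?thesis using assms by (simp add: powr_minus field_simps)
qed

theorem theorem2p2:
  fixes k :: nat and lam :: real and s :: complex
  assumes "k \<ge> 1"
    and "0 < lam" and "lam < 1 / (real k + 1)"
    and "real k < Re s" and "Re s < (1 - lam) / lam"
  shows "degenerate_Gamma lam (s + 1) =
           (\<Prod>j=0..k. s - of_nat j) /
           ((\<Prod>j=1..k. complex_of_real (1 - real j * lam)) *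
             complex_of_real (1 - (real k + 1) * lam) powr (s - of_nat k + 1)) *
           degenerate_Gamma (lam / (1 - (real k + 1) * lam)) (s - of_nat k)"
proof -
  define c where "c = 1 - (real k + 1) * lam"
  have c: "c > 0" using assms by (simp add: c_def field_simps)
  have "degenerate_Gamma lam (s + 1) =
      (\<Prod>j<Suc k. s - of_nat j) / (\<Prod>j=1..Suc k. of_real ((1 / lam - real j) * lam))
        * beta_integral lam (1 / lam - real (Suc k)) (s + 1 - of_nat (Suc k))"
    unfolding degenerate_Gamma_eq_beta_integral
    using assms by (intro beta_integral_iterated) (auto simp: field_simps)
  also have "(\<Prod>j=1..Suc k. complex_of_real ((1 / lam - real j) * lam))
      = (\<Prod>j=1..Suc k. complex_of_real (1 - real j * lam))"
    using assms by (intro prod.cong refl arg_cong[of _ _ complex_of_real]) (simp add: field_simps)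
  also have "\<dots> = (\<Prod>j=1..k. complex_of_real (1 - real j * lam)) * of_real c"
    by (simp add: c_def add_ac)
  also have "(\<Prod>j<Suc k. s - of_nat j) = (\<Prod>j=0..k. s - of_nat j)"
    by (simp only: lessThan_Suc_atMost atLeast0AtMost)
  also have "1 / lam - real (Suc k) = 1 / (lam / c)"
    using assms c by (simp add: c_def field_simps)
  also have "s + 1 - of_nat (Suc k) = s - of_nat k" by simp
  also have "beta_integral lam (1 / (lam / c)) (s - of_nat k)
      = of_real c powr (- (s - of_nat k)) * degenerate_Gamma (lam / c) (s - of_nat k)"
    using beta_integral_rescale[OF c, of "lam / c"] c
    by (simp add: degenerate_Gamma_eq_beta_integral)
  finally show ?thesis
    using c powr_add[of "of_real c :: complex" "s - of_nat k" 1] unfolding c_def[symmetric]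
    by (simp only: powr_minus) (simp add: divide_simps mult_ac)
qed

end
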